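(* Let $q$ be a prime with $q\equiv 3 \pmod 4$. For every $E\subset \mathbb{F}_q^{2}\times\mathbb{F}_q^2=\mathbb{F}_q^4$ and every $a\in\mathbb{F}_q$ with $a\neq 0$, $$\sum_{m\in\mathbb{F}_q^2,\ \Vert m\Vert=a} \left|\widehat{E}(m,\vec{0})\right|^2 \le 3^{\frac12}\, q^{-6}\,|E|^{\frac32},$$ where $\vec 0$ is the zero vector of $\mathbb{F}_q^2$.
   Context: For $m=(m_1,m_2)\in\mathbb{F}_q^2$ write $\Vert m\Vert=m_1^2+m_2^2\in\mathbb{F}_q$. A set $E$ is identified with its indicator function. Let $\chi$ be a fixed nontrivial additive character of $\mathbb{F}_q$ (the principal additive character). For $E\subset\mathbb{F}_q^4$ and $(m',m'')\in\mathbb{F}_q^2\times\mathbb{F}_q^2$, the Fourier transform is $$\widehat{E}(m',m'')=q^{-4}\sum_{x',x''\in\mathbb{F}_q^2}\chi(-x'\cdot m'-x''\cdot m'')E(x',x''),$$ with $\cdot$ the standard dot product. *)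

theory Defs
  imports "HOL-Analysis.Analysis" "HOL-Number_Theory.Cong" "HOL-Computational_Algebra.Primes"
begin

text \<open>
  The field with q elements is a type \<open>'a\<close> of class field and finite with \<open>CARD('a) = q\<close>;
  its plane is \<open>'a ^ 2\<close>, and the four-dimensional space is \<open>('a ^ 2) \<times> ('a ^ 2)\<close>.
\<close>

text \<open>Not the library's real-valued norm: the value lies in the field.\<close>
definition fnorm :: "('a::field) ^ 2 \<Rightarrow> 'a" where
  "fnorm m = (m $ 1)\<^sup>2 + (m $ 2)\<^sup>2"

definition fdot :: "('a::field) ^ 2 \<Rightarrow> 'a ^ 2 \<Rightarrow> 'a" where
  "fdot x y = (\<Sum>i\<in>UNIV. x $ i * y $ i)"

definition additive_character :: "('a::field \<Rightarrow> complex) \<Rightarrow> bool" where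
  "additive_character \<psi> \<longleftrightarrow> (\<forall>x. cmod (\<psi> x) = 1) \<and> (\<forall>x y. \<psi> (x + y) = \<psi> x * \<psi> y)"

definition nontrivial_additive_character :: "('a::field \<Rightarrow> complex) \<Rightarrow> bool" where
  "nontrivial_additive_character \<psi> \<longleftrightarrow> additive_character \<psi> \<and> (\<exists>x. \<psi> x \<noteq> 1)"

definition fourier_set ::
  "('a::{field,finite} \<Rightarrow> complex) \<Rightarrow> (('a ^ 2) \<times> ('a ^ 2)) set \<Rightarrow> ('a ^ 2) \<times> ('a ^ 2) \<Rightarrow> complex" where
  "fourier_set \<psi> E = (\<lambda>(m', m''). of_nat CARD('a) powi (-4) *
     (\<Sum>x'\<in>UNIV. \<Sum>x''\<in>UNIV. \<psi> (- fdot x' m' - fdot x'' m'') * indicator E (x', x'')))"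

end

theory Submission
  imports Defs "HOL-Number_Theory.Residues"
begin

text \<open>
  Write \<open>f x\<close> for the number of \<open>y\<close> with \<open>(x, y) \<in> E\<close>, so that \<open>0 \<le> f \<le> q\<^sup>2\<close> and \<open>q\<^sup>4\<close> times the
  transform of \<open>E\<close> at \<open>(m, 0)\<close> is the planar exponential sum \<open>F m\<close> of \<open>f\<close>. Let \<open>A\<close> be the sum of
  \<open>\<bar>F\<bar>\<^sup>2\<close> over the circle, \<open>g\<close> the restriction of \<open>cnj F\<close> to the circle and \<open>G\<close> the exponential
  sum of \<open>g\<close>. By duality \<open>A = \<Sum>f G\<close>, and two applications of Cauchy--Schwarz give
  \<open>A\<^sup>4 \<le> (\<Sum>f)\<^sup>2 (\<Sum>f\<^sup>2) (\<Sum>\<bar>G\<bar>\<^sup>4)\<close>. By Plancherel, the last factor is \<open>q\<^sup>2\<close> times the squared \<open>L\<^sup>2\<close>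
  norm of \<open>g * g\<close>. Since \<open>-1\<close> is not a square, a nonzero vector is a sum of two points of the circle
  in at most two ways, whence \<open>\<Sum>\<bar>G\<bar>\<^sup>4 \<le> 3 q\<^sup>2 A\<^sup>2\<close>, and so \<open>A\<^sup>2 \<le> 3 q\<^sup>4 \<bar>E\<bar>\<^sup>3\<close>.
\<close>

text \<open>The library has this only for the class \<open>finite_field\<close>.\<close>
lemma finite_field_power_card_minus_1:
  fixes x :: "'a::{field,finite}"
  assumes "x \<noteq> 0"
  shows "x ^ (CARD('a) - 1) = 1"
proof -
  let ?U = "UNIV - {0::'a}"
  have "(\<Prod>y\<in>?U. x * y) = \<Prod>?U"
    by (rule prod.reindex_bij_witness[of _ "\<lambda>y. y / x" "\<lambda>y. x * y"]) (use assms in auto)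
  then have "x ^ card ?U * \<Prod>?U = \<Prod>?U"
    by (simp add: prod.distrib)
  moreover have "\<Prod>?U \<noteq> 0"
    by simp
  ultimately show ?thesis
    by (simp add: card_Diff_singleton)
qed

lemma two_neq_zero_if_odd_CARD:
  assumes "odd CARD('a::{field,finite})"
  shows "(2::'a) \<noteq> 0"
proof
  assume "(2::'a) = 0"
  then have "CHAR('a) dvd 2"
    using of_nat_eq_0_iff_char_dvd[of 2, where 'a = 'a] by simp
  moreover have "CHAR('a) dvd CARD('a)"
    by (rule CHAR_dvd_CARD)
  moreover have "coprime 2 CARD('a)"
    using assms by simp
  ultimately have "CHAR('a) = 1"
    using coprime_common_divisor by (metis nat_dvd_1_iff_1)
  then show False
    by simp
qed

lemma minus_one_not_square:
  fixes x :: "'a::{field,finite}"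
  assumes "CARD('a) mod 4 = 3" and "(2::'a) \<noteq> 0"
  shows "x\<^sup>2 \<noteq> -1"
proof
  assume x: "x\<^sup>2 = -1"
  define k where "k = CARD('a) div 4"
  have "CARD('a) = 4 * k + 3"
    using assms(1) mod_mult_div_eq[of "CARD('a)" 4] unfolding k_def by linarith
  then have k: "CARD('a) - 1 = 2 * (2 * k + 1)"
    by simp
  have "x \<noteq> 0"
    using x by auto
  then have "1 = (x\<^sup>2) ^ (2 * k + 1)"
    unfolding power_mult[symmetric] k[symmetric] by (rule finite_field_power_card_minus_1[symmetric])
  also have "\<dots> = -1"
    by (simp add: x)
  finally have "(2::'a) = 0"
    by (metis add.right_inverse one_add_one)
  then show False
    using assms(2) by simp
qed

lemma fnorm_eq_0_iff:
  fixes v :: "'a::{field,finite} ^ 2"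
  assumes "CARD('a) mod 4 = 3" and "(2::'a) \<noteq> 0"
  shows "fnorm v = 0 \<longleftrightarrow> v = 0"
proof
  assume 0: "fnorm v = 0"
  have "v $ 2 = 0"
  proof (rule ccontr)
    assume "v $ 2 \<noteq> 0"
    moreover have "(v $ 1)\<^sup>2 = - ((v $ 2)\<^sup>2)"
      using 0 by (simp add: fnorm_def eq_neg_iff_add_eq_0)
    ultimately have "(v $ 1 / v $ 2)\<^sup>2 = -1"
      by (simp add: power_divide)
    then show False
      using minus_one_not_square[OF assms] by blast
  qed
  with 0 show "v = 0"
    by (simp add: fnorm_def vec_eq_iff forall_2)
qed (simp add: fnorm_def)

lemma card_square_roots_le_2:
  fixes c :: "'a::{field,finite}"
  shows "card {w. w\<^sup>2 = c} \<le> 2"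
proof (cases "\<exists>w. w\<^sup>2 = c")
  case True
  then obtain w where "w\<^sup>2 = c" by blast
  then have "{u. u\<^sup>2 = c} = {w, -w}"
    using power2_eq_iff by auto
  then show ?thesis
    by (simp add: card_insert_if)
qed simp

lemma card_circle_representations_le_2:
  fixes v :: "'a::{field,finite} ^ 2"
  assumes "fnorm v \<noteq> 0" and two: "(2::'a) \<noteq> 0"
  shows "card {m. fnorm m = a \<and> fnorm (v - m) = a} \<le> 2"
proof -
  let ?M = "{m. fnorm m = a \<and> fnorm (v - m) = a}"
  let ?w = "\<lambda>m::'a^2. v $ 1 * m $ 2 - v $ 2 * m $ 1"
  let ?c = "fnorm v / 2"
  have dot: "v $ 1 * m $ 1 + v $ 2 * m $ 2 = ?c" if "m \<in> ?M" for m
  proof -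
    have "2 * (v $ 1 * m $ 1 + v $ 2 * m $ 2) = fnorm v + fnorm m - fnorm (v - m)"
      unfolding fnorm_def vector_minus_component by (simp add: power2_eq_square algebra_simps)
    then have "2 * (v $ 1 * m $ 1 + v $ 2 * m $ 2) = fnorm v"
      using that by (simp only: mem_Collect_eq add_diff_cancel_right')
    then show ?thesis
      using two by (simp add: field_simps)
  qed
  have sq: "(?w m)\<^sup>2 = fnorm v * a - ?c\<^sup>2" if "m \<in> ?M" for m
  proof -
    have "(?w m)\<^sup>2 = fnorm v * fnorm m - (v $ 1 * m $ 1 + v $ 2 * m $ 2)\<^sup>2"
      unfolding fnorm_def by (simp add: power2_eq_square algebra_simps)
    then show ?thesis
      using dot[OF that] that by simp
  qed
  have solve: "fnorm v * m $ 1 = v $ 1 * (v $ 1 * m $ 1 + v $ 2 * m $ 2) - v $ 2 * ?w m"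
    "fnorm v * m $ 2 = v $ 2 * (v $ 1 * m $ 1 + v $ 2 * m $ 2) + v $ 1 * ?w m" for m
    unfolding fnorm_def by (simp_all add: power2_eq_square algebra_simps)
  have "inj_on ?w ?M"
  proof (rule inj_onI)
    fix m n assume mn: "m \<in> ?M" "n \<in> ?M" "?w m = ?w n"
    have d: "v $ 1 * m $ 1 + v $ 2 * m $ 2 = v $ 1 * n $ 1 + v $ 2 * n $ 2"
      using dot[OF mn(1)] dot[OF mn(2)] by (rule trans[OF _ sym])
    have "fnorm v * m $ 1 = fnorm v * n $ 1" "fnorm v * m $ 2 = fnorm v * n $ 2"
      by (simp_all only: solve d mn(3))
    then show "m = n"
      using assms(1) by (simp add: vec_eq_iff forall_2)
  qed
  then have "card ?M = card (?w ` ?M)"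
    by (simp add: card_image)
  also have "\<dots> \<le> card {w. w\<^sup>2 = fnorm v * a - ?c\<^sup>2}"
    by (rule card_mono) (use sq in auto)
  also have "\<dots> \<le> 2"
    by (rule card_square_roots_le_2)
  finally show ?thesis .
qed

lemma fdot_add_left: "fdot (x + y) m = fdot x m + fdot y m"
  by (simp add: fdot_def sum.distrib algebra_simps)

lemma fdot_add_right: "fdot x (m + n) = fdot x m + fdot x n"
  by (simp add: fdot_def sum.distrib algebra_simps)

lemma fdot_diff_right: "fdot x (m - n) = fdot x m - fdot x n"
  by (simp add: fdot_def sum_subtractf algebra_simps)

lemma fdot_0_right [simp]: "fdot x 0 = 0"
  by (simp add: fdot_def)

locale plane_character =
  fixes \<psi> :: "'a::{field,finite} \<Rightarrow> complex"
  assumes nontrivial: "nontrivial_additive_character \<psi>"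
begin

lemma cmod_character [simp]: "cmod (\<psi> x) = 1"
  using nontrivial by (simp add: nontrivial_additive_character_def additive_character_def)

lemma character_add: "\<psi> (x + y) = \<psi> x * \<psi> y"
  using nontrivial by (simp add: nontrivial_additive_character_def additive_character_def)

lemma character_0: "\<psi> 0 = 1"
proof -
  have "\<psi> 0 \<noteq> 0"
    by (metis cmod_character norm_zero zero_neq_one)
  moreover have "\<psi> 0 * \<psi> 0 = \<psi> 0 * 1"
    using character_add[of 0 0] by (simp only: add_0_left mult_1_right)
  ultimately show ?thesis
    using mult_left_cancel by blast
qed

lemma cnj_character: "cnj (\<psi> x) = \<psi> (- x)"
proof -
  have "\<psi> x * \<psi> (- x) = 1"
    using character_add[of x "- x"] by (simp add: character_0)
  moreover have "cnj (\<psi> x) * \<psi> x = 1"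
    by (metis complex_norm_square cmod_character mult.commute of_real_1 one_power2)
  ultimately show ?thesis
    by (metis mult.assoc mult.left_neutral mult.right_neutral)
qed

lemma sum_character_fdot:
  "(\<Sum>x\<in>UNIV. \<psi> (fdot x v)) = (if v = 0 then of_nat (CARD('a) ^ 2) else 0)"
proof (cases "v = 0")
  case True
  then show ?thesis
    by (simp add: character_0)
next
  case False
  then obtain i where i: "v $ i \<noteq> 0"
    by (auto simp: vec_eq_iff)
  obtain t where t: "\<psi> t \<noteq> 1"
    using nontrivial by (auto simp: nontrivial_additive_character_def)
  define y where "y = axis i (t / v $ i)"
  have "fdot y v = (\<Sum>j\<in>UNIV. if j = i then t else 0)"
    unfolding fdot_def y_def by (rule sum.cong) (use i in \<open>auto simp: axis_def\<close>)
  then have y: "fdot y v = t"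
    by simp
  have "(\<Sum>x\<in>UNIV. \<psi> (fdot x v)) = (\<Sum>x\<in>UNIV. \<psi> (fdot (x + y) v))"
    by (rule sum.reindex_bij_witness[of _ "\<lambda>x. x + y" "\<lambda>x. x - y"]) auto
  also have "\<dots> = \<psi> t * (\<Sum>x\<in>UNIV. \<psi> (fdot x v))"
    by (simp add: fdot_add_left y character_add sum_distrib_left mult.commute)
  finally show ?thesis
    using t False by simp
qed

definition expsum :: "('a ^ 2 \<Rightarrow> complex) \<Rightarrow> 'a ^ 2 \<Rightarrow> complex" where
  "expsum h x = (\<Sum>v\<in>UNIV. h v * \<psi> (- fdot x v))"

lemma plancherel:
  "(\<Sum>x\<in>UNIV. (cmod (expsum h x))\<^sup>2) = real (CARD('a) ^ 2) * (\<Sum>v\<in>UNIV. (cmod (h v))\<^sup>2)"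
proof -
  have "complex_of_real (\<Sum>x\<in>UNIV. (cmod (expsum h x))\<^sup>2)
      = (\<Sum>x\<in>UNIV. \<Sum>v\<in>UNIV. \<Sum>w\<in>UNIV. h v * cnj (h w) * \<psi> (fdot x (w - v)))"
    unfolding of_real_sum complex_norm_square expsum_def
    by (simp add: sum_product cnj_character fdot_diff_right mult_ac
        flip: character_add)
  also have "\<dots> = (\<Sum>v\<in>UNIV. \<Sum>x\<in>UNIV. \<Sum>w\<in>UNIV. h v * cnj (h w) * \<psi> (fdot x (w - v)))"
    by (rule sum.swap)
  also have "\<dots> = (\<Sum>v\<in>UNIV. \<Sum>w\<in>UNIV. \<Sum>x\<in>UNIV. h v * cnj (h w) * \<psi> (fdot x (w - v)))"
    by (intro sum.cong refl sum.swap)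
  also have "\<dots> = (\<Sum>v\<in>UNIV. \<Sum>w\<in>UNIV. if w = v then h v * cnj (h w) * of_nat (CARD('a) ^ 2) else 0)"
    unfolding sum_distrib_left[symmetric] sum_character_fdot by (intro sum.cong refl) auto
  also have "\<dots> = complex_of_real (real (CARD('a) ^ 2) * (\<Sum>v\<in>UNIV. (cmod (h v))\<^sup>2))"
    unfolding of_real_mult of_real_sum complex_norm_square sum_distrib_left
    by (simp add: mult.commute)
  finally show ?thesis
    unfolding of_real_eq_iff .
qed

lemma expsum_square:
  "(expsum g x)\<^sup>2 = expsum (\<lambda>v. \<Sum>m\<in>UNIV. g m * g (v - m)) x"
proof -
  have "(expsum g x)\<^sup>2 = (\<Sum>m\<in>UNIV. \<Sum>n\<in>UNIV. g m * g n * \<psi> (- fdot x (m + n)))"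
    by (simp add: expsum_def power2_eq_square sum_product fdot_add_right mult_ac
        flip: character_add)
  also have "\<dots> = (\<Sum>m\<in>UNIV. \<Sum>v\<in>UNIV. g m * g (v - m) * \<psi> (- fdot x v))"
  proof (rule sum.cong[OF refl])
    fix m
    show "(\<Sum>n\<in>UNIV. g m * g n * \<psi> (- fdot x (m + n))) = (\<Sum>v\<in>UNIV. g m * g (v - m) * \<psi> (- fdot x v))"
      by (rule sum.reindex_bij_witness[of _ "\<lambda>v. v - m" "\<lambda>n. m + n"]) auto
  qed
  also have "\<dots> = (\<Sum>v\<in>UNIV. \<Sum>m\<in>UNIV. g m * g (v - m) * \<psi> (- fdot x v))"
    by (rule sum.swap)
  finally show ?thesis
    by (simp add: expsum_def sum_distrib_right)
qed

end

lemma convolution_circle_L2_bound: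
  fixes g :: "'a::{field,finite} ^ 2 \<Rightarrow> complex"
  assumes mod4: "CARD('a) mod 4 = 3" and two: "(2::'a) \<noteq> 0"
    and supp: "\<And>m. fnorm m \<noteq> a \<Longrightarrow> g m = 0"
  shows "(\<Sum>v\<in>UNIV. (cmod (\<Sum>m\<in>UNIV. g m * g (v - m)))\<^sup>2) \<le> 3 * (\<Sum>m\<in>UNIV. (cmod (g m))\<^sup>2)\<^sup>2"
proof -
  define A where "A = (\<Sum>m\<in>UNIV. (cmod (g m))\<^sup>2)"
  define B where "B v = (\<Sum>m\<in>UNIV. (cmod (g m))\<^sup>2 * (cmod (g (v - m)))\<^sup>2)" for v
  let ?h = "\<lambda>v. cmod (\<Sum>m\<in>UNIV. g m * g (v - m))"
  have triangle: "?h v \<le> (\<Sum>m\<in>UNIV. cmod (g m) * cmod (g (v - m)))" for v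
    by (rule order_trans[OF norm_sum]) (simp add: norm_mult)
  have reindex: "(\<Sum>m\<in>UNIV. (cmod (g (v - m)))\<^sup>2) = A" for v
    unfolding A_def by (rule sum.reindex_bij_witness[of _ "\<lambda>m. v - m" "\<lambda>m. v - m"]) auto
  have zero: "(?h 0)\<^sup>2 \<le> A\<^sup>2"
  proof -
    have "(?h 0)\<^sup>2 \<le> (\<Sum>m\<in>UNIV. cmod (g m) * cmod (g (0 - m)))\<^sup>2"
      by (intro power_mono triangle) simp
    also have "\<dots> \<le> A * (\<Sum>m\<in>UNIV. (cmod (g (0 - m)))\<^sup>2)"
      unfolding A_def by (rule Cauchy_Schwarz_ineq_sum)
    finally show ?thesis
      unfolding reindex power2_eq_square[of A] .
  qed
  have nonzero: "(?h v)\<^sup>2 \<le> 2 * B v" if "v \<noteq> 0" for v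
  proof -
    let ?M = "{m. fnorm m = a \<and> fnorm (v - m) = a}"
    have "(\<Sum>m\<in>UNIV. cmod (g m) * cmod (g (v - m))) = (\<Sum>m\<in>?M. cmod (g m) * cmod (g (v - m)))"
      by (rule sum.mono_neutral_right) (use supp in auto)
    then have "?h v \<le> (\<Sum>m\<in>?M. cmod (g m) * cmod (g (v - m)))"
      using triangle[of v] by (simp only:)
    then have "(?h v)\<^sup>2 \<le> (\<Sum>m\<in>?M. cmod (g m) * cmod (g (v - m)))\<^sup>2"
      by (rule power_mono) simp
    also have "\<dots> \<le> (\<Sum>m\<in>?M. (cmod (g m) * cmod (g (v - m)))\<^sup>2) * real (card ?M)"
      by (rule sum_squared_le_sum_of_squares)
    also have "\<dots> \<le> B v * 2"
    proof (rule mult_mono)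
      show "(\<Sum>m\<in>?M. (cmod (g m) * cmod (g (v - m)))\<^sup>2) \<le> B v"
        unfolding B_def power_mult_distrib by (rule sum_mono2) auto
      have "card ?M \<le> 2"
        using that card_circle_representations_le_2[OF _ two] fnorm_eq_0_iff[OF mod4 two] by blast
      then show "real (card ?M) \<le> 2"
        by linarith
    qed (auto simp: B_def intro!: sum_nonneg)
    finally show ?thesis by simp
  qed
  have "(\<Sum>v\<in>UNIV. B v) = (\<Sum>m\<in>UNIV. \<Sum>v\<in>UNIV. (cmod (g m))\<^sup>2 * (cmod (g (v - m)))\<^sup>2)"
    unfolding B_def by (rule sum.swap)
  also have "\<dots> = (\<Sum>m\<in>UNIV. \<Sum>n\<in>UNIV. (cmod (g m))\<^sup>2 * (cmod (g n))\<^sup>2)"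
    by (intro sum.cong refl sum.reindex_bij_witness[of _ "\<lambda>n. n + m" "\<lambda>v. v - m" for m]) auto
  also have "\<dots> = A\<^sup>2"
    by (simp add: A_def power2_eq_square sum_product)
  finally have B: "(\<Sum>v\<in>UNIV. B v) = A\<^sup>2" .
  have "(\<Sum>v\<in>UNIV. (?h v)\<^sup>2) = (?h 0)\<^sup>2 + (\<Sum>v\<in>UNIV-{0}. (?h v)\<^sup>2)"
    by (rule sum.remove) auto
  also have "\<dots> \<le> A\<^sup>2 + (\<Sum>v\<in>UNIV-{0}. 2 * B v)"
    by (intro add_mono zero sum_mono nonzero) auto
  also have "\<dots> \<le> A\<^sup>2 + (\<Sum>v\<in>UNIV. 2 * B v)"
    by (intro add_mono order_refl sum_mono2) (auto simp: B_def intro!: sum_nonneg)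
  also have "\<dots> = 3 * A\<^sup>2"
    by (simp add: sum_distrib_left[symmetric] B)
  finally show ?thesis
    by (simp add: A_def)
qed

lemma Cauchy_Schwarz_fourth_power:
  fixes f G :: "'b \<Rightarrow> real"
  assumes "\<And>x. x \<in> I \<Longrightarrow> 0 \<le> f x"
  shows "(\<Sum>x\<in>I. f x * G x) ^ 4 \<le> (\<Sum>x\<in>I. f x)\<^sup>2 * ((\<Sum>x\<in>I. (f x)\<^sup>2) * (\<Sum>x\<in>I. G x ^ 4))"
proof -
  have "(\<Sum>x\<in>I. f x * G x) = (\<Sum>x\<in>I. sqrt (f x) * (sqrt (f x) * G x))"
    using assms by (intro sum.cong refl) (simp add: mult.assoc[symmetric])
  then have "(\<Sum>x\<in>I. f x * G x)\<^sup>2 = (\<Sum>x\<in>I. sqrt (f x) * (sqrt (f x) * G x))\<^sup>2"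
    by (rule arg_cong)
  also have "\<dots> \<le> (\<Sum>x\<in>I. (sqrt (f x))\<^sup>2) * (\<Sum>x\<in>I. (sqrt (f x) * G x)\<^sup>2)"
    by (rule Cauchy_Schwarz_ineq_sum)
  also have "\<dots> = (\<Sum>x\<in>I. f x) * (\<Sum>x\<in>I. f x * (G x)\<^sup>2)"
    by (intro arg_cong2[where f = "(*)"] sum.cong) (use assms in \<open>auto simp: power_mult_distrib\<close>)
  finally have "((\<Sum>x\<in>I. f x * G x)\<^sup>2)\<^sup>2 \<le> ((\<Sum>x\<in>I. f x) * (\<Sum>x\<in>I. f x * (G x)\<^sup>2))\<^sup>2"
    by (rule power_mono) simp
  also have "\<dots> \<le> (\<Sum>x\<in>I. f x)\<^sup>2 * ((\<Sum>x\<in>I. (f x)\<^sup>2) * (\<Sum>x\<in>I. ((G x)\<^sup>2)\<^sup>2))"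
    unfolding power_mult_distrib by (intro mult_left_mono Cauchy_Schwarz_ineq_sum) simp
  finally show ?thesis
    by simp
qed

context plane_character
begin

lemma circle_restriction_bound:
  fixes f :: "'a ^ 2 \<Rightarrow> real" and a :: 'a
  assumes mod4: "CARD('a) mod 4 = 3" and two: "(2::'a) \<noteq> 0" and f: "\<And>x. 0 \<le> f x"
  defines "A \<equiv> \<Sum>m | fnorm m = a. (cmod (expsum (\<lambda>x. of_real (f x)) m))\<^sup>2"
  shows "A\<^sup>2 \<le> 3 * real (CARD('a) ^ 2) * (\<Sum>x\<in>UNIV. f x)\<^sup>2 * (\<Sum>x\<in>UNIV. (f x)\<^sup>2)"
proof -
  define F where "F = expsum (\<lambda>x. of_real (f x))"
  define g where "g m = (if fnorm m = a then cnj (F m) else 0)" for m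
  have A0: "0 \<le> A"
    unfolding A_def by (rule sum_nonneg) simp
  have A: "A = (\<Sum>m\<in>UNIV. (cmod (g m))\<^sup>2)"
    unfolding A_def g_def F_def[symmetric] by (rule sum.mono_neutral_cong_left) auto
  have "complex_of_real A = (\<Sum>m\<in>UNIV. g m * F m)"
    unfolding A of_real_sum complex_norm_square by (intro sum.cong refl) (simp add: g_def)
  also have "\<dots> = (\<Sum>m\<in>UNIV. \<Sum>x\<in>UNIV. of_real (f x) * (g m * \<psi> (- fdot x m)))"
    unfolding F_def expsum_def sum_distrib_left
    by (intro sum.cong refl) (simp add: fdot_def mult_ac)
  also have "\<dots> = (\<Sum>x\<in>UNIV. \<Sum>m\<in>UNIV. of_real (f x) * (g m * \<psi> (- fdot x m)))"
    by (rule sum.swap)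
  also have "\<dots> = (\<Sum>x\<in>UNIV. of_real (f x) * expsum g x)"
    by (simp add: expsum_def sum_distrib_left)
  finally have duality: "complex_of_real A = (\<Sum>x\<in>UNIV. of_real (f x) * expsum g x)" .
  have "A = cmod (complex_of_real A)"
    using A0 by simp
  also have "\<dots> \<le> (\<Sum>x\<in>UNIV. f x * cmod (expsum g x))"
    unfolding duality by (rule order_trans[OF norm_sum]) (simp add: norm_mult f)
  finally have A_le: "A \<le> (\<Sum>x\<in>UNIV. f x * cmod (expsum g x))" .
  have "(\<Sum>x\<in>UNIV. cmod (expsum g x) ^ 4) = (\<Sum>x\<in>UNIV. (cmod ((expsum g x)\<^sup>2))\<^sup>2)"
    by (simp add: norm_power)
  also have "\<dots> = real (CARD('a) ^ 2) * (\<Sum>v\<in>UNIV. (cmod (\<Sum>m\<in>UNIV. g m * g (v - m)))\<^sup>2)"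
    unfolding expsum_square by (rule plancherel)
  also have "\<dots> \<le> real (CARD('a) ^ 2) * (3 * A\<^sup>2)"
    unfolding A by (intro mult_left_mono convolution_circle_L2_bound[OF mod4 two, of a]) (auto simp: g_def)
  finally have L4: "(\<Sum>x\<in>UNIV. cmod (expsum g x) ^ 4) \<le> real (CARD('a) ^ 2) * (3 * A\<^sup>2)" .
  let ?S = "\<Sum>x\<in>UNIV. f x" and ?T = "\<Sum>x\<in>UNIV. (f x)\<^sup>2"
  have "A ^ 4 \<le> (\<Sum>x\<in>UNIV. f x * cmod (expsum g x)) ^ 4"
    by (rule power_mono[OF A_le A0])
  also have "\<dots> \<le> ?S\<^sup>2 * (?T * (\<Sum>x\<in>UNIV. cmod (expsum g x) ^ 4))"
    by (rule Cauchy_Schwarz_fourth_power) (rule f)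
  also have "\<dots> \<le> ?S\<^sup>2 * (?T * (real (CARD('a) ^ 2) * (3 * A\<^sup>2)))"
    by (intro mult_left_mono L4 sum_nonneg) auto
  finally have cancel: "A\<^sup>2 * A\<^sup>2 \<le> (3 * real (CARD('a) ^ 2) * ?S\<^sup>2 * ?T) * A\<^sup>2"
    by (simp add: mult_ac flip: power_add)
  show ?thesis
  proof (cases "A = 0")
    case True
    then show ?thesis
      by (simp add: sum_nonneg)
  next
    case False
    then show ?thesis
      using cancel by (simp only: mult_le_cancel_right_pos zero_less_power2 not_False_eq_True)
  qed
qed

end

theorem lemma3p2:
  fixes q :: nat
    and \<psi> :: "'a::{field,finite} \<Rightarrow> complex"
    and E :: "(('a ^ 2) \<times> ('a ^ 2)) set"
    and a :: 'a
  assumes "CARD('a) = q"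
    and "prime q"
    and "[q = 3] (mod 4)"
    and "nontrivial_additive_character \<psi>"
    and "a \<noteq> 0"
  shows "(\<Sum>m | fnorm m = a. (cmod (fourier_set \<psi> E (m, 0)))\<^sup>2)
           \<le> 3 powr (1/2) * real q powi (-6) * real (card E) powr (3/2)"
proof -
  interpret plane_character \<psi>
    by unfold_locales (rule assms)
  have mod4: "CARD('a) mod 4 = 3"
    using assms(1,3) by (simp add: cong_def)
  then have "odd CARD('a)"
    by presburger
  then have two: "(2::'a) \<noteq> 0"
    using two_neq_zero_if_odd_CARD by blast
  have q: "real q > 0"
    using assms(2) by (simp add: prime_gt_0_nat)
  define f :: "'a ^ 2 \<Rightarrow> real" where "f x = (\<Sum>y\<in>UNIV. indicator E (x, y))" for x
  define A where "A = (\<Sum>m | fnorm m = a. (cmod (expsum (\<lambda>x. of_real (f x)) m))\<^sup>2)"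
  define N where "N = real (card E)"
  have f0: "0 \<le> f x" for x
    unfolding f_def by (rule sum_nonneg) simp
  have "f x \<le> (\<Sum>y\<in>(UNIV :: ('a ^ 2) set). 1)" for x
    unfolding f_def by (rule sum_mono) (simp add: indicator_def)
  then have f_le: "f x \<le> (real q)\<^sup>2" for x
    by (simp add: assms(1))
  have "(\<Sum>x\<in>UNIV. f x) = (\<Sum>z\<in>UNIV. indicator E z)"
    unfolding f_def by (simp add: sum.cartesian_product)
  then have sum_f: "(\<Sum>x\<in>UNIV. f x) = N"
    by (simp add: N_def indicator_def)
  have "(\<Sum>x\<in>UNIV. (f x)\<^sup>2) \<le> (\<Sum>x\<in>UNIV. (real q)\<^sup>2 * f x)"
    unfolding power2_eq_square[of "f _"] by (intro sum_mono mult_right_mono f_le f0)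
  then have sum_f2: "(\<Sum>x\<in>UNIV. (f x)\<^sup>2) \<le> (real q)\<^sup>2 * N"
    by (simp add: sum_distrib_left[symmetric] sum_f)
  have "A\<^sup>2 \<le> 3 * (real q)\<^sup>2 * N\<^sup>2 * (\<Sum>x\<in>UNIV. (f x)\<^sup>2)"
    using circle_restriction_bound[OF mod4 two, of f a] f0 by (simp add: A_def sum_f assms(1))
  also have "\<dots> \<le> 3 * (real q)\<^sup>2 * N\<^sup>2 * ((real q)\<^sup>2 * N)"
    by (intro mult_left_mono sum_f2) simp
  also have "\<dots> = 3 * ((real q)\<^sup>2)\<^sup>2 * N ^ 3"
    by (simp add: power2_eq_square power3_eq_cube)
  finally have "A \<le> sqrt (3 * ((real q)\<^sup>2)\<^sup>2 * N ^ 3)"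
    by (rule real_le_rsqrt)
  also have "\<dots> = sqrt 3 * (real q)\<^sup>2 * sqrt (N ^ 3)"
    by (simp only: real_sqrt_mult real_sqrt_abs abs_power2)
  also have "sqrt (N ^ 3) = N powr (3/2)"
  proof (cases "N = 0")
    case False
    then have "N > 0"
      unfolding N_def by linarith
    then show ?thesis
      by (simp add: powr_half_sqrt[symmetric] powr_powr flip: powr_numeral)
  qed simp
  finally have A_le: "A \<le> 3 powr (1/2) * (real q)\<^sup>2 * N powr (3/2)"
    by (simp add: powr_half_sqrt)
  have of_real_f: "complex_of_real (f x) = (\<Sum>y\<in>UNIV. indicator E (x, y))" for x
    unfolding f_def of_real_sum by (intro sum.cong refl) (simp add: indicator_def)
  have "fourier_set \<psi> E (m, 0) = of_nat q powi (-4) * expsum (\<lambda>x. of_real (f x)) m" for m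
    unfolding fourier_set_def expsum_def of_real_f sum_distrib_right
    by (simp add: assms(1) fdot_def mult_ac)
  then have "(\<Sum>m | fnorm m = a. (cmod (fourier_set \<psi> E (m, 0)))\<^sup>2) = (real q powi (-4))\<^sup>2 * A"
    by (simp add: A_def norm_mult norm_power_int power_mult_distrib sum_distrib_left)
  also have "\<dots> \<le> (real q powi (-4))\<^sup>2 * (3 powr (1/2) * (real q)\<^sup>2 * N powr (3/2))"
    by (intro mult_left_mono A_le) simp
  also have "\<dots> = 3 powr (1/2) * real q powi (-6) * N powr (3/2)"
    using q by (simp add: power_int_minus field_simps flip: power_add)
  finally show ?thesis
    by (simp add: N_def)
qed

end
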